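(* Let $n\ge 2$, $p,q,r\in(0,\infty]$ and $s\ge 0$. The following continuous embeddings hold between spaces on $\mathbb{R}^n$. (I) The case $r=q$. (I-i) If $r=q=\infty$, then $W^{p,\infty}_s\hookrightarrow W^{p,\infty,\infty}_s$. (I-ii) If $r=q<\infty$, then $W^{p,q}_s\hookrightarrow W^{p,q,q}_s$. (II) The case $r<q$. (II-i) If $q=\infty$ and $s>1/r$, then $W^{p,\infty}_s\hookrightarrow W^{p,\infty,r}_{s'}$ for any $s'\in(-\infty,\,s-1/r)$. (II-ii) If $q<\infty$ and $s>1/r-1/q$, then $W^{p,q}_s\hookrightarrow W^{p,q,r}_{s'}$ for any $s'\in(-\infty,\,s-(1/r-1/q))$. (III) The case $q<r$. (III-i) If $r=\infty$, then $W^{p,q}_s\hookrightarrow W^{p,q,\infty}_s$. (III-ii) If $r<\infty$, then $W^{p,q}_s\hookrightarrow W^{p,q,r}_s$.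
   Context: Notation: $\langle k\rangle=(1+|k|^2)^{1/2}$; $\mathcal{S}'$ denotes the tempered distributions; $\hat f(\xi)=\mathcal{F}f(\xi)=\int e^{-2\pi i x\cdot\xi}f(x)\,dx$. For $k\in\mathbb{Z}^n$ write $k=(\bar{k},k_n)$ with $\bar{k}=(k_1,\dots,k_{n-1})\in\mathbb{Z}^{n-1}$. Here $X\hookrightarrow Y$ means $X\subset Y$ and $\|f\|_Y\le C\|f\|_X$ for all $f\in X$, with $C$ independent of $f$. Frequency-uniform decomposition: let $\eta:\mathbb{R}\to[0,1]$ be a smooth function with $\eta(\xi)=1$ for $|\xi|\le 1$ and $\eta(\xi)=0$ for $|\xi|\ge 2$. For $k\in\mathbb{Z}^n$ and $\xi\in\mathbb{R}^n$ put $\phi_{k_i}(\xi_i)=\eta(2(\xi_i-k_i))$, $$\varphi_k(\xi)=\frac{\phi_{k_1}(\xi_1)\cdots\phi_{k_n}(\xi_n)}{\sum_{m\in\mathbb{Z}^n}\phi_{m_1}(\xi_1)\cdots\phi_{m_n}(\xi_n)},\qquad \square_k f=\mathcal{F}^{-1}(\varphi_k\hat f).$$ Wiener amalgam spaces: for $0<p,q\le\infty$ and $s\in\mathbb{R}$, $W^{p,q}_s=W^{p,q}_s(\mathbb{R}^n)$ is the space of all $f\in\mathcal{S}'(\mathbb{R}^n)$ with $$\|f\|_{W^{p,q}_s}=\Big\|\,\big\|\{\langle k\rangle^s\square_k f\}_{k\in\mathbb{Z}^n}\big\|_{\ell^q}\Big\|_{L^p(\mathbb{R}^n)}<\infty.$$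 Anisotropic Wiener amalgam spaces: for $0<p,q,r\le\infty$ and $s\in\mathbb{R}$, $W^{p,q,r}_s=W^{p,q,r}_s(\mathbb{R}^n)$ is the space of all $f\in\mathcal{S}'(\mathbb{R}^n)$ with $$\|f\|_{W^{p,q,r}_s}=\Big\|\Big(\sum_{k_n\in\mathbb{Z}}\Big(\sum_{\bar{k}\in\mathbb{Z}^{n-1}}\langle\bar{k}\rangle^{sq}|\square_k f|^q\Big)^{r/q}\Big)^{1/r}\Big\|_{L^p(\mathbb{R}^n)}<\infty,$$ where, if $q=\infty$, the inner expression $(\sum_{\bar{k}}\langle\bar{k}\rangle^{sq}|\square_kf|^q)^{1/q}$ is replaced by $\sup_{\bar{k}}\langle\bar{k}\rangle^{s}|\square_kf|$, and if $r=\infty$ the outer $\ell^r$ (quasi-)norm over $k_n$ is replaced by the supremum over $k_n$. *)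

theory Defs
  imports "HOL-Analysis.Analysis"
begin

section \<open>Smooth functions and Schwartz functions\<close>

text \<open>
  Iterated directional derivatives. \<open>smooth\<close> means that all iterated partial derivatives are
  (Frechet) differentiable everywhere, i.e. that the function is of class \<open>C\<^sup>\<infinity>\<close>.
\<close>

primrec pderivs :: "'a::euclidean_space list \<Rightarrow> ('a \<Rightarrow> 'b::real_normed_vector) \<Rightarrow> 'a \<Rightarrow> 'b" where
  "pderivs [] f = f"
| "pderivs (v # vs) f = (\<lambda>x. frechet_derivative (pderivs vs f) (at x) v)"

definition smooth :: "('a::euclidean_space \<Rightarrow> 'b::real_normed_vector) \<Rightarrow> bool" where
  "smooth f \<longleftrightarrow> (\<forall>vs\<in>lists Basis. \<forall>x. pderivs vs f differentiable (at x))"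

text \<open>The expression \<open>x\<^sup>\<alpha> \<partial>\<^sup>\<beta> f(x)\<close>, with \<open>\<beta>\<close> given as a list of coordinate directions.\<close>

definition weighted_deriv ::
    "('a \<Rightarrow> nat) \<Rightarrow> 'a list \<Rightarrow> ('a::euclidean_space \<Rightarrow> complex) \<Rightarrow> 'a \<Rightarrow> complex" where
  "weighted_deriv \<alpha> \<beta> f x = of_real (\<Prod>b\<in>Basis. (x \<bullet> b) ^ \<alpha> b) * pderivs \<beta> f x"

definition schwartz :: "('a::euclidean_space \<Rightarrow> complex) set" where
  "schwartz = {f. smooth f \<and> (\<forall>\<alpha>. \<forall>\<beta>\<in>lists Basis. bounded (range (weighted_deriv \<alpha> \<beta> f)))}"

definition schwartz_seminorm ::
    "('a \<Rightarrow> nat) \<Rightarrow> 'a list \<Rightarrow> ('a::euclidean_space \<Rightarrow> complex) \<Rightarrow> real" where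
  "schwartz_seminorm \<alpha> \<beta> f = (SUP x. norm (weighted_deriv \<alpha> \<beta> f x))"

definition schwartz_topology :: "('a::euclidean_space \<Rightarrow> complex) topology" where
  "schwartz_topology = topology_generated_by
     {{g \<in> schwartz. schwartz_seminorm \<alpha> \<beta> (\<lambda>x. g x - f x) < \<epsilon>} | f \<alpha> \<beta> \<epsilon>.
        f \<in> schwartz \<and> \<beta> \<in> lists Basis \<and> \<epsilon> > 0}"


section \<open>Tempered distributions\<close>

text \<open>
  Tempered distributions are the continuous linear functionals on the Schwartz space. They are
  \<open>extensional\<close> so that two of them are equal iff they agree on all Schwartz functions.
\<close>

type_synonym 'a functional = "('a \<Rightarrow> complex) \<Rightarrow> complex"

definition tempered :: "'a::euclidean_space functional set" where
  "tempered = {u \<in> extensional schwartz.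
     (\<forall>f\<in>schwartz. \<forall>g\<in>schwartz. u (\<lambda>x. f x + g x) = u f + u g) \<and>
     (\<forall>c. \<forall>f\<in>schwartz. u (\<lambda>x. c * f x) = c * u f) \<and>
     continuous_map schwartz_topology euclidean u}"

definition fourier :: "('a::euclidean_space \<Rightarrow> complex) \<Rightarrow> 'a \<Rightarrow> complex" where
  "fourier f \<xi> = (\<integral>x. exp (- 2 * of_real pi * \<i> * of_real (x \<bullet> \<xi>)) * f x \<partial>lborel)"

definition inv_fourier :: "('a::euclidean_space \<Rightarrow> complex) \<Rightarrow> 'a \<Rightarrow> complex" where
  "inv_fourier f x = (\<integral>\<xi>. exp (2 * of_real pi * \<i> * of_real (x \<bullet> \<xi>)) * f \<xi> \<partial>lborel)"

text \<open>On tempered distributions, these operations are defined by duality.\<close>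

definition fourier_distr :: "'a::euclidean_space functional \<Rightarrow> 'a functional" where
  "fourier_distr u = (\<lambda>\<psi>\<in>schwartz. u (fourier \<psi>))"

definition inv_fourier_distr :: "'a::euclidean_space functional \<Rightarrow> 'a functional" where
  "inv_fourier_distr u = (\<lambda>\<psi>\<in>schwartz. u (inv_fourier \<psi>))"

definition mult_distr :: "('a::euclidean_space \<Rightarrow> real) \<Rightarrow> 'a functional \<Rightarrow> 'a functional" where
  "mult_distr \<phi> u = (\<lambda>\<psi>\<in>schwartz. u (\<lambda>x. of_real (\<phi> x) * \<psi> x))"

text \<open>
  The continuous function representing a regular distribution. If there is one, it is unique.
\<close>

definition function_of_distr :: "'a::euclidean_space functional \<Rightarrow> 'a \<Rightarrow> complex" where
  "function_of_distr u = (THE g. continuous_on UNIV g \<and>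
     (\<forall>\<psi>\<in>schwartz. integrable lborel (\<lambda>x. g x * \<psi> x) \<and> u \<psi> = (\<integral>x. g x * \<psi> x \<partial>lborel)))"


section \<open>Frequency-uniform decomposition\<close>

definition cutoff :: "(real \<Rightarrow> real) \<Rightarrow> bool" where
  "cutoff \<eta> \<longleftrightarrow> smooth \<eta> \<and> range \<eta> \<subseteq> {0..1} \<and>
     (\<forall>\<xi>. \<bar>\<xi>\<bar> \<le> 1 \<longrightarrow> \<eta> \<xi> = 1) \<and> (\<forall>\<xi>. \<bar>\<xi>\<bar> \<ge> 2 \<longrightarrow> \<eta> \<xi> = 0)"

definition cube_bump :: "(real \<Rightarrow> real) \<Rightarrow> int ^ 'n \<Rightarrow> real ^ 'n::finite \<Rightarrow> real" where
  "cube_bump \<eta> k \<xi> = (\<Prod>i\<in>UNIV. \<eta> (2 * (\<xi> $ i - of_int (k $ i))))"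

text \<open>The sum in the denominator is locally finite.\<close>

definition freq_window :: "(real \<Rightarrow> real) \<Rightarrow> int ^ 'n \<Rightarrow> real ^ 'n::finite \<Rightarrow> real" where
  "freq_window \<eta> k \<xi> = cube_bump \<eta> k \<xi> / (\<Sum>\<^sub>\<infinity>m\<in>UNIV. cube_bump \<eta> m \<xi>)"

text \<open>
  The distribution \<open>\<F>\<^sup>-\<^sup>1 (\<phi>\<^sub>k \<F> f)\<close> has a compactly supported Fourier transform,
  hence it is given by a smooth function.
\<close>

definition freq_box ::
    "(real \<Rightarrow> real) \<Rightarrow> int ^ 'n \<Rightarrow> (real ^ 'n::finite) functional \<Rightarrow> real ^ 'n \<Rightarrow> complex" where
  "freq_box \<eta> k f =
     function_of_distr (inv_fourier_distr (mult_distr (freq_window \<eta> k) (fourier_distr f)))"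


section \<open>Mixed quasi-norms\<close>

definition ennpowr :: "ennreal \<Rightarrow> real \<Rightarrow> ennreal" where
  "ennpowr x a = (if x = \<infinity> then \<infinity> else ennreal (enn2real x powr a))"

text \<open>
  Quasi-norms of \<open>[0,\<infinity>]\<close>-valued functions for exponents in \<open>(0,\<infinity>]\<close>. For the exponent \<open>\<infinity>\<close>,
  \<open>Lp_norm\<close> is the essential supremum.
\<close>

definition Lp_norm :: "ennreal \<Rightarrow> ('a::euclidean_space \<Rightarrow> ennreal) \<Rightarrow> ennreal" where
  "Lp_norm p F =
     (if p = \<infinity> then Inf {c. AE x in lborel. F x \<le> c}
      else ennpowr (\<integral>\<^sup>+x. ennpowr (F x) (enn2real p) \<partial>lborel) (1 / enn2real p))"

definition lq_norm :: "ennreal \<Rightarrow> 'i set \<Rightarrow> ('i \<Rightarrow> ennreal) \<Rightarrow> ennreal" where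
  "lq_norm q I a =
     (if q = \<infinity> then (SUP i\<in>I. a i)
      else ennpowr (\<Sum>\<^sub>\<infinity>i\<in>I. ennpowr (a i) (enn2real q)) (1 / enn2real q))"


section \<open>Wiener amalgam spaces\<close>

text \<open>
  The coordinates of \<^typ>\<open>real ^ 'n\<close> are indexed by a finite linear order; the greatest index
  plays the role of \<open>n\<close>. The sum over \<open>\<Z>\<^bsup>n-1\<^esup>\<close> for a fixed last component \<open>j\<close>
  ranges over all \<open>k\<close> with last component \<open>j\<close>.
\<close>

definition last_index :: "'n::{finite,linorder}" where
  "last_index = Max UNIV"

definition bracket :: "int ^ 'n::finite \<Rightarrow> real" where
  "bracket k = sqrt (1 + (\<Sum>i\<in>UNIV. (of_int (k $ i))\<^sup>2))"

definition bracket_bar :: "int ^ 'n::{finite,linorder} \<Rightarrow> real" where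
  "bracket_bar k = sqrt (1 + (\<Sum>i\<in>UNIV - {last_index}. (of_int (k $ i))\<^sup>2))"

definition wiener_norm ::
    "(real \<Rightarrow> real) \<Rightarrow> ennreal \<Rightarrow> ennreal \<Rightarrow> real \<Rightarrow> (real ^ 'n::finite) functional \<Rightarrow> ennreal" where
  "wiener_norm \<eta> p q s f =
     Lp_norm p (\<lambda>x. lq_norm q UNIV (\<lambda>k. ennreal (bracket k powr s * norm (freq_box \<eta> k f x))))"

definition aniso_wiener_norm ::
    "(real \<Rightarrow> real) \<Rightarrow> ennreal \<Rightarrow> ennreal \<Rightarrow> ennreal \<Rightarrow> real \<Rightarrow>
     (real ^ 'n::{finite,linorder}) functional \<Rightarrow> ennreal" where
  "aniso_wiener_norm \<eta> p q r s f =
     Lp_norm p (\<lambda>x. lq_norm r (UNIV :: int set) (\<lambda>j. lq_norm q {k. k $ last_index = j}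
       (\<lambda>k. ennreal (bracket_bar k powr s * norm (freq_box \<eta> k f x)))))"

text \<open>A quasi-normed space is given as the pair of its carrier and its quasi-norm.\<close>

type_synonym 'n distr_space = "(real ^ 'n) functional set \<times> ((real ^ 'n) functional \<Rightarrow> ennreal)"

definition wiener_amalgam ::
    "(real \<Rightarrow> real) \<Rightarrow> ennreal \<Rightarrow> ennreal \<Rightarrow> real \<Rightarrow> 'n::finite distr_space" where
  "wiener_amalgam \<eta> p q s =
     ({f \<in> tempered. wiener_norm \<eta> p q s f < \<infinity>}, wiener_norm \<eta> p q s)"

definition aniso_wiener_amalgam ::
    "(real \<Rightarrow> real) \<Rightarrow> ennreal \<Rightarrow> ennreal \<Rightarrow> ennreal \<Rightarrow> real \<Rightarrow> 'n::{finite,linorder} distr_space" where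
  "aniso_wiener_amalgam \<eta> p q r s =
     ({f \<in> tempered. aniso_wiener_norm \<eta> p q r s f < \<infinity>}, aniso_wiener_norm \<eta> p q r s)"

definition cont_embedded :: "'n distr_space \<Rightarrow> 'n distr_space \<Rightarrow> bool"
    (infix \<open>\<hookrightarrow>\<close> 50) where
  "X \<hookrightarrow> Y \<longleftrightarrow> fst X \<subseteq> fst Y \<and>
     (\<exists>C::real. C > 0 \<and> (\<forall>f\<in>fst X. snd Y f \<le> ennreal C * snd X f))"

end

theory Submission
  imports Defs
begin

text \<open>
  The box functions \<open>\<box>\<^sub>k f\<close> enter both quasi-norms only through the numbers
  \<open>c k = \<bar>\<box>\<^sub>k f(x)\<bar>\<close> at a single point \<open>x\<close>, so everything follows from an inequality between
  the two sequence quasi-norms of an arbitrary nonnegative family \<open>c\<close> on the lattice, with a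
  constant independent of \<open>c\<close>. The outer \<open>L\<^sup>p\<close> quasi-norm is monotone and homogeneous
  (\<open>Lp_norm_le_cmult\<close>), which transfers this inequality to the function spaces
  (\<open>embedding_of_pointwise_bound\<close>). Below, \<open>k\<^sub>n\<close> is the last component of \<open>k\<close>, \<open>k\<^bsub>bar\<^esub>\<close> is the vector
  of the others, and \<open>\<langle>j\<rangle>\<close> for an integer \<open>j\<close> is the square root of \<open>1 + j\<^sup>2\<close>.

  If \<open>r = q\<close>, summing over slices \<open>k\<^sub>n = j\<close> and then over \<open>j\<close> is summing over
  the whole lattice (\<open>lq_norm_slices_le\<close>), and \<open>\<langle>k\<^bsub>bar\<^esub>\<rangle> \<le> \<langle>k\<rangle>\<close> compares the weights. If \<open>q < r\<close>,
  the embedding \<open>\<ell>\<^sup>q \<subseteq> \<ell>\<^sup>r\<close> for the sum over \<open>j\<close> is applied first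
  (\<open>lq_norm_antimono_exponent\<close>).

  If \<open>r < q\<close>, passing from \<open>\<ell>\<^sup>q\<close> down to \<open>\<ell>\<^sup>r\<close> in \<open>j\<close> costs a weight. By Hoelder's inequality it
  is enough to have a factor \<open>\<langle>j\<rangle>\<^sup>t\<close> with \<open>t > 1/r - 1/q\<close>, because then
  \<open>\<langle>j\<rangle>\<^sup>-\<^sup>t\<close> raised to the power \<open>1/(1/r - 1/q)\<close> is summable over the integers
  (\<open>lq_norm_le_weighted\<close>, \<open>summable_on_int_bracket\<close>). The factor is taken from the gap between
  \<open>s\<close> and \<open>s'\<close>: for \<open>t = s - max s' 0\<close> one has
  \<open>\<langle>k\<^sub>n\<rangle>\<^sup>t \<langle>k\<^bsub>bar\<^esub>\<rangle>\<^bsup>s'\<^esup> \<le> \<langle>k\<rangle>\<^sup>s\<close> (\<open>bracket_weight_split\<close>). The maximum is there because \<open>s'\<close> may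
  be negative, in which case \<open>\<langle>k\<^bsub>bar\<^esub>\<rangle>\<^bsup>s'\<^esup>\<close> is only bounded by \<open>1\<close>.
\<close>

section \<open>Powers of extended nonnegative reals\<close>

lemma ennpowr_ennreal: "x \<ge> 0 \<Longrightarrow> ennpowr (ennreal x) a = ennreal (x powr a)"
  by (simp add: ennpowr_def)

lemma ennpowr_0 [simp]: "ennpowr 0 a = 0"
  by (simp add: ennpowr_def)

lemma ennpowr_top [simp]: "ennpowr top a = top"
  by (simp add: ennpowr_def)

lemma ennpowr_1 [simp]: "ennpowr 1 a = 1"
  by (simp add: ennpowr_def)

lemma ennpowr_one_right [simp]: "ennpowr x 1 = x"
  by (cases x) (auto simp: ennpowr_ennreal)

lemma ennpowr_mono:
  assumes "a > 0" "x \<le> y"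
  shows "ennpowr x a \<le> ennpowr y a"
proof (cases y)
  case (real v)
  with assms obtain u where "x = ennreal u" "u \<ge> 0"
    by (cases x) (auto simp: top_unique)
  with real assms show ?thesis
    by (auto simp: ennpowr_ennreal intro!: ennreal_leI powr_mono2)
qed simp

text \<open>
  The convention \<open>0 * \<infinity> = 0\<close> matches \<open>0 powr a = 0\<close>, so multiplicativity survives at the
  endpoints for every real exponent.
\<close>

lemma ennpowr_mult: "ennpowr (x * y) a = ennpowr x a * ennpowr y a"
proof -
  have eq_0: "ennpowr z a = 0 \<longleftrightarrow> z = 0" for z
    by (cases z) (simp_all add: ennpowr_ennreal)
  show ?thesis
  proof (cases x; cases y)
    fix u v assume "0 \<le> u" "x = ennreal u" "0 \<le> v" "y = ennreal v"
    then show ?thesis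
      by (simp add: ennpowr_ennreal powr_mult flip: ennreal_mult)
  next
    fix u assume "0 \<le> u" "x = ennreal u" "y = top"
    then show ?thesis
      using eq_0[of x] by (cases "x = 0")
        (simp_all only: ennreal_mult_top ennpowr_top ennpowr_0 if_True if_False simp_thms mult_zero_left)
  next
    fix v assume "x = top" "0 \<le> v" "y = ennreal v"
    then show ?thesis
      using eq_0[of y] by (cases "y = 0")
        (simp_all only: ennreal_top_mult ennpowr_top ennpowr_0 if_True if_False simp_thms mult_zero_right)
  qed (simp add: ennreal_top_mult)
qed

lemma ennpowr_ennpowr: "ennpowr (ennpowr x a) b = ennpowr x (a * b)"
  by (cases x) (auto simp: ennpowr_ennreal powr_powr)

lemma ennpowr_add:
  assumes "a > 0" "b > 0"
  shows "ennpowr x (a + b) = ennpowr x a * ennpowr x b"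
  by (cases x) (auto simp: ennpowr_ennreal powr_add simp flip: ennreal_mult)

lemma ennpowr_inverse_le_iff:
  assumes "a > 0"
  shows "ennpowr x (1 / a) \<le> y \<longleftrightarrow> x \<le> ennpowr y a"
proof
  assume "ennpowr x (1 / a) \<le> y"
  from ennpowr_mono[OF assms this] assms show "x \<le> ennpowr y a"
    by (simp add: ennpowr_ennpowr)
next
  assume "x \<le> ennpowr y a"
  from ennpowr_mono[OF _ this, of "1 / a"] assms show "ennpowr x (1 / a) \<le> y"
    by (simp add: ennpowr_ennpowr)
qed

lemma enn2real_exponent_pos:
  fixes q :: ennreal
  assumes "q > 0" "q \<noteq> \<infinity>"
  shows "enn2real q > 0"
  using assms by (simp add: enn2real_positive_iff less_top)


section \<open>Infinite sums of extended nonnegative reals\<close>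

lemma ennreal_summable_on_any:
  fixes f :: "'a \<Rightarrow> ennreal"
  shows "f summable_on A"
  by (rule nonneg_summable_on_complete) simp

lemma infsum_ennreal_eq_SUP:
  fixes f :: "'a \<Rightarrow> ennreal"
  shows "infsum f A = (SUP F\<in>{F. finite F \<and> F \<subseteq> A}. sum f F)"
  by (rule nonneg_infsum_complete) simp

lemma infsum_ennreal_cmult:
  fixes f :: "'a \<Rightarrow> ennreal"
  shows "(\<Sum>\<^sub>\<infinity>i\<in>A. c * f i) = c * infsum f A"
  by (simp add: infsum_ennreal_eq_SUP SUP_mult_left_ennreal sum_distrib_left)

lemma infsum_ennreal_mono:
  fixes f g :: "'a \<Rightarrow> ennreal"
  assumes "\<And>i. i \<in> A \<Longrightarrow> f i \<le> g i"
  shows "infsum f A \<le> infsum g A"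
  by (rule infsum_mono) (use assms in \<open>auto intro: ennreal_summable_on_any\<close>)

lemma ennreal_le_infsum:
  fixes f :: "'a \<Rightarrow> ennreal"
  assumes "i \<in> A"
  shows "f i \<le> infsum f A"
  unfolding infsum_ennreal_eq_SUP
  by (rule SUP_upper2[of "{i}"]) (use assms in auto)

lemma sum_infsum_slices:
  fixes f :: "'a \<Rightarrow> ennreal"
  assumes "finite J"
  shows "(\<Sum>j\<in>J. infsum f {k. \<pi> k = j}) = infsum f {k. \<pi> k \<in> J}"
  using assms
proof induction
  case (insert j J)
  have "{k. \<pi> k \<in> insert j J} = {k. \<pi> k = j} \<union> {k. \<pi> k \<in> J}"
    by auto
  then have "infsum f {k. \<pi> k \<in> insert j J} = infsum f {k. \<pi> k = j} + infsum f {k. \<pi> k \<in> J}"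
    using insert.hyps by (simp only:) (rule infsum_Un_disjoint, auto intro: ennreal_summable_on_any)
  with insert show ?case
    by simp
qed simp

text \<open>
  The slices partition the index set, so a finite partial sum of slice sums is the sum over a subset
  of the index set.
\<close>

lemma infsum_slices_le:
  fixes f :: "'a \<Rightarrow> ennreal"
  shows "(\<Sum>\<^sub>\<infinity>j\<in>UNIV. infsum f {k. \<pi> k = j}) \<le> infsum f UNIV"
  unfolding infsum_ennreal_eq_SUP[of "\<lambda>j. infsum f {k. \<pi> k = j}"]
  by (rule SUP_least)
    (auto simp: sum_infsum_slices intro!: infsum_mono_neutral ennreal_summable_on_any)

lemma infsum_ennreal_finite:
  fixes f :: "'a \<Rightarrow> real"
  assumes "f summable_on A" "\<And>i. i \<in> A \<Longrightarrow> f i \<ge> 0"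
  shows "(\<Sum>\<^sub>\<infinity>i\<in>A. ennreal (f i)) < \<infinity>"
proof -
  have "(\<Sum>\<^sub>\<infinity>i\<in>A. ennreal (f i)) = (SUP F\<in>{F. finite F \<and> F \<subseteq> A}. ennreal (sum f F))"
    unfolding infsum_ennreal_eq_SUP
    by (intro SUP_cong refl sum_ennreal) (use assms(2) in auto)
  also have "\<dots> = ennreal (infsum f A)"
    using infsum_nonneg_is_SUPREMUM_ennreal[of f A] assms by auto
  finally show ?thesis
    by simp
qed


section \<open>Sequence quasi-norms\<close>

lemma lq_norm_mono:
  assumes "q > 0" "\<And>i. i \<in> I \<Longrightarrow> a i \<le> b i"
  shows "lq_norm q I a \<le> lq_norm q I b"
proof (cases "q = \<infinity>")
  case True
  with assms show ?thesis
    by (auto simp: lq_norm_def intro!: SUP_mono)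
next
  case False
  with assms enn2real_exponent_pos[of q] show ?thesis
    by (auto simp: lq_norm_def intro!: ennpowr_mono infsum_ennreal_mono)
qed

lemma lq_norm_cmult:
  assumes "q > 0"
  shows "lq_norm q I (\<lambda>i. c * a i) = c * lq_norm q I a"
proof (cases "q = \<infinity>")
  case True
  then show ?thesis
    by (simp add: lq_norm_def SUP_mult_left_ennreal)
next
  case False
  with assms enn2real_exponent_pos[of q] show ?thesis
    by (simp add: lq_norm_def ennpowr_mult infsum_ennreal_cmult ennpowr_ennpowr)
qed

lemma le_lq_norm:
  assumes "q > 0" "i \<in> I"
  shows "a i \<le> lq_norm q I a"
proof (cases "q = \<infinity>")
  case True
  with assms show ?thesis
    by (metis lq_norm_def SUP_upper)
next
  case False
  let ?q = "enn2real q"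
  have q: "?q > 0"
    using assms False by (intro enn2real_exponent_pos)
  have "ennpowr (ennpowr (a i) ?q) (1 / ?q) \<le> ennpowr (\<Sum>\<^sub>\<infinity>i\<in>I. ennpowr (a i) ?q) (1 / ?q)"
    using q ennreal_le_infsum[OF assms(2), of "\<lambda>i. ennpowr (a i) ?q"] by (intro ennpowr_mono) auto
  with q False show ?thesis
    by (simp add: ennpowr_ennpowr lq_norm_def)
qed

lemma ennpowr_lq_norm:
  assumes "q > 0" "q \<noteq> \<infinity>"
  shows "ennpowr (lq_norm q I a) (enn2real q) = (\<Sum>\<^sub>\<infinity>i\<in>I. ennpowr (a i) (enn2real q))"
  using assms enn2real_exponent_pos[of q] by (simp add: lq_norm_def ennpowr_ennpowr)

lemma lq_norm_le_iff:
  assumes "q > 0" "q \<noteq> \<infinity>"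
  shows "lq_norm q I a \<le> c \<longleftrightarrow> (\<Sum>\<^sub>\<infinity>i\<in>I. ennpowr (a i) (enn2real q)) \<le> ennpowr c (enn2real q)"
  using assms enn2real_exponent_pos[of q] by (simp add: lq_norm_def ennpowr_inverse_le_iff)

lemma lq_norm_slices_le:
  assumes "q > 0"
  shows "lq_norm q UNIV (\<lambda>j. lq_norm q {k. \<pi> k = j} a) \<le> lq_norm q UNIV a"
proof (cases "q = \<infinity>")
  case True
  then show ?thesis
    by (auto simp: lq_norm_def intro!: SUP_least SUP_upper)
next
  case False
  with assms show ?thesis
    by (simp add: lq_norm_le_iff ennpowr_lq_norm infsum_slices_le)
qed

text \<open>
  For finite exponents, each term is dominated by the whole norm \<open>B\<close>, so
  \<open>(a i)\<^sup>r \<le> B\<^bsup>r - q\<^esup> (a i)\<^sup>q\<close>; summing gives \<open>B\<^bsup>r - q\<^esup> B\<^sup>q = B\<^sup>r\<close>.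
\<close>

lemma lq_norm_antimono_exponent:
  assumes "0 < q" "q \<le> r"
  shows "lq_norm r I a \<le> lq_norm q I a"
proof (cases "r = \<infinity>")
  case True
  with assms show ?thesis
    by (auto simp: lq_norm_def[of top] intro: SUP_least le_lq_norm)
next
  case False
  show ?thesis
  proof (cases "q = r")
    case False
    let ?q = "enn2real q" and ?r = "enn2real r"
    define B where "B = lq_norm q I a"
    have fin: "q \<noteq> \<infinity>" "r \<noteq> \<infinity>" "r > 0"
      using assms \<open>r \<noteq> \<infinity>\<close> by (auto simp: top_unique)
    have q: "0 < ?q" "?q < ?r"
      using assms fin False by (auto simp: enn2real_exponent_pos enn2real_less_iff less_top)
    have "ennpowr (a i) ?r \<le> ennpowr B (?r - ?q) * ennpowr (a i) ?q" if "i \<in> I" for i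
    proof -
      have "ennpowr (a i) ?r = ennpowr (a i) (?r - ?q) * ennpowr (a i) ?q"
        using ennpowr_add[of "?r - ?q" ?q "a i"] q by simp
      also have "\<dots> \<le> ennpowr B (?r - ?q) * ennpowr (a i) ?q"
        using le_lq_norm[OF \<open>0 < q\<close> that, of a] q unfolding B_def
        by (intro mult_right_mono ennpowr_mono) auto
      finally show ?thesis .
    qed
    then have "(\<Sum>\<^sub>\<infinity>i\<in>I. ennpowr (a i) ?r) \<le> (\<Sum>\<^sub>\<infinity>i\<in>I. ennpowr B (?r - ?q) * ennpowr (a i) ?q)"
      by (rule infsum_ennreal_mono)
    also have "\<dots> = ennpowr B (?r - ?q) * ennpowr B ?q"
      using assms fin by (simp add: infsum_ennreal_cmult ennpowr_lq_norm B_def)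
    also have "\<dots> = ennpowr B ?r"
      using ennpowr_add[of "?r - ?q" ?q B] q by simp
    finally show ?thesis
      using fin by (simp add: lq_norm_le_iff B_def)
  qed simp
qed

text \<open>
  The case \<open>q = \<infinity>\<close> is included: \<open>enn2real \<infinity> = 0\<close> and \<open>1 / 0 = 0\<close>, so that \<open>1 / enn2real q\<close> is the
  usual \<open>1/q\<close> for all \<open>q\<close>.
\<close>

lemma exponent_gap_pos:
  fixes q r :: ennreal
  assumes "0 < r" "r < q"
  shows "1 / enn2real r - 1 / enn2real q > 0"
proof -
  have r: "enn2real r > 0"
    using assms by (intro enn2real_exponent_pos) auto
  show ?thesis
  proof (cases "q = \<infinity>")
    case False
    then have "enn2real r < enn2real q"
      using assms by (simp add: enn2real_less_iff less_top)
    with r show ?thesis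
      by (simp add: field_simps)
  qed (use r in simp)
qed

text \<open>
  A termwise substitute for Hoelder's inequality. With \<open>\<theta> = r/q\<close>, the left side is the weighted
  geometric mean \<open>x\<^sup>\<theta> y\<^bsup>1 - \<theta>\<^esup>\<close> of the two summands \<open>x\<close> and \<open>y\<close> on the right, hence at most their
  maximum.
\<close>

lemma powr_le_powr_add_weight:
  fixes \<beta> w q r :: real
  assumes "0 < r" "r < q" "\<beta> \<ge> 0" "w > 0"
  shows "\<beta> powr r \<le> (w * \<beta>) powr q + w powr (- (1 / (1 / r - 1 / q)))"
proof -
  define x where "x = (w * \<beta>) powr q"
  define y where "y = w powr (- (1 / (1 / r - 1 / q)))"
  define \<theta> where "\<theta> = r / q"
  have \<theta>: "0 < \<theta>" "\<theta> < 1"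
    using assms by (auto simp: \<theta>_def)
  have xy: "x \<ge> 0" "y > 0"
    using assms by (auto simp: x_def y_def)
  have "x powr \<theta> = (w * \<beta>) powr r"
    using assms by (simp add: x_def \<theta>_def powr_powr)
  moreover have "y powr (1 - \<theta>) = w powr (- r)"
  proof -
    have "1 / (1 / r - 1 / q) * (1 - \<theta>) = r"
      using assms by (simp add: \<theta>_def field_simps)
    then show ?thesis
      by (simp add: y_def powr_powr)
  qed
  ultimately have "\<beta> powr r = x powr \<theta> * y powr (1 - \<theta>)"
    using assms by (simp add: powr_mult powr_minus)
  also have "\<dots> \<le> max x y powr \<theta> * max x y powr (1 - \<theta>)"
    using xy \<theta> by (intro mult_mono powr_mono2) auto
  also have "\<dots> = max x y"
    using xy by (simp flip: powr_add)
  also have "\<dots> \<le> x + y"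
    using xy by simp
  finally show ?thesis
    by (simp add: x_def y_def)
qed

text \<open>
  Summing the termwise bound for \<open>q < \<infinity>\<close> gives the \<open>q\<close>-th power of the weighted
  norm plus a constant. This is not homogeneous of degree \<open>r\<close> in \<open>b\<close>, which is why the norm is first normalised to be at most \<open>1\<close>.
\<close>

lemma lq_norm_weighted_normalised:
  fixes w :: "'i \<Rightarrow> real"
  assumes rq: "0 < r" "r < q" and w: "\<And>i. w i > 0"
    and le1: "lq_norm q I (\<lambda>i. ennreal (w i) * b i) \<le> 1"
  shows "lq_norm r I b \<le> ennpowr (1 + (\<Sum>\<^sub>\<infinity>i\<in>I.
    ennreal (w i powr (- (1 / (1 / enn2real r - 1 / enn2real q)))))) (1 / enn2real r)"
proof -
  let ?q = "enn2real q" and ?r = "enn2real r"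
  let ?v = "\<lambda>i. w i powr (- (1 / (1 / ?r - 1 / ?q)))"
  let ?u = "\<lambda>i. ennreal (w i) * b i"
  have q0: "q > 0"
    using rq by simp
  have r: "r \<noteq> \<infinity>" "?r > 0"
    using rq by (auto intro: enn2real_exponent_pos)
  have u1: "?u i \<le> 1" if "i \<in> I" for i
    using le_lq_norm[OF q0 that, of ?u] le1 by (rule order_trans)
  have b_real: "\<exists>\<beta>\<ge>0. b i = ennreal \<beta> \<and> w i * \<beta> \<le> 1" if "i \<in> I" for i
  proof (cases "b i")
    case (real \<beta>)
    with u1[OF that] w[of i] show ?thesis
      by (intro exI[of _ \<beta>]) (auto simp flip: ennreal_mult)
  next
    case top
    with u1[OF that] w[of i] show ?thesis
      by (simp add: ennreal_mult_top top_unique)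
  qed
  \<comment> \<open>If \<open>q = \<infinity>\<close>, the weight is \<open>w i powr - ?r\<close>, and \<open>w i * b i \<le> 1\<close> bounds each term by it.\<close>
  have "(\<Sum>\<^sub>\<infinity>i\<in>I. ennpowr (b i) ?r) \<le> 1 + (\<Sum>\<^sub>\<infinity>i\<in>I. ennreal (?v i))"
  proof (cases "q = \<infinity>")
    case True
    have "ennpowr (b i) ?r \<le> ennreal (?v i)" if i: "i \<in> I" for i
    proof -
      from b_real[OF i] obtain \<beta> where \<beta>: "\<beta> \<ge> 0" "b i = ennreal \<beta>" "w i * \<beta> \<le> 1"
        by auto
      have "\<beta> \<le> 1 / w i"
        using \<beta> w[of i] by (simp add: field_simps)
      then have "\<beta> powr ?r \<le> (1 / w i) powr ?r"
        using \<beta> r by (intro powr_mono2) auto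
      also have "\<dots> = ?v i"
        using True w[of i] by (simp add: powr_minus powr_divide field_simps)
      finally show ?thesis
        using \<beta> by (simp add: ennpowr_ennreal ennreal_leI)
    qed
    then have "(\<Sum>\<^sub>\<infinity>i\<in>I. ennpowr (b i) ?r) \<le> (\<Sum>\<^sub>\<infinity>i\<in>I. ennreal (?v i))"
      by (rule infsum_ennreal_mono)
    then show ?thesis
      by (simp add: add_increasing)
  next
    case False
    have rq': "?r < ?q"
      using rq False by (simp add: enn2real_less_iff less_top)
    have "ennpowr (b i) ?r \<le> ennpowr (?u i) ?q + ennreal (?v i)" if i: "i \<in> I" for i
    proof -
      from b_real[OF i] obtain \<beta> where \<beta>: "\<beta> \<ge> 0" "b i = ennreal \<beta>"
        by auto
      have "ennpowr (?u i) ?q = ennreal ((w i * \<beta>) powr ?q)"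
        using \<beta> w[of i] by (simp add: ennpowr_ennreal flip: ennreal_mult)
      with powr_le_powr_add_weight[OF r(2) rq' \<beta>(1) w[of i]] \<beta> show ?thesis
        by (simp add: ennpowr_ennreal flip: ennreal_plus)
    qed
    then have "(\<Sum>\<^sub>\<infinity>i\<in>I. ennpowr (b i) ?r) \<le> (\<Sum>\<^sub>\<infinity>i\<in>I. ennpowr (?u i) ?q + ennreal (?v i))"
      by (rule infsum_ennreal_mono)
    also have "\<dots> = (\<Sum>\<^sub>\<infinity>i\<in>I. ennpowr (?u i) ?q) + (\<Sum>\<^sub>\<infinity>i\<in>I. ennreal (?v i))"
      by (intro infsum_add ennreal_summable_on_any)
    also have "(\<Sum>\<^sub>\<infinity>i\<in>I. ennpowr (?u i) ?q) \<le> 1"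
      using le1 False q0 by (simp add: lq_norm_le_iff)
    finally show ?thesis
      by (simp add: add_right_mono)
  qed
  then show ?thesis
    using r rq by (simp add: lq_norm_le_iff ennpowr_ennpowr)
qed

text \<open>
  Hoelder's inequality in the form \<open>\<ell>\<^sup>q(w) \<subseteq> \<ell>\<^sup>r\<close>, for weights whose inverses are in
  \<open>\<ell>\<^bsup>\<kappa>\<^esup>\<close> with \<open>\<kappa> = 1/(1/r - 1/q)\<close>. It follows from the normalised case by scaling; a vanishing
  norm cannot be normalised, but it forces \<open>b = 0\<close>.
\<close>

lemma lq_norm_le_weighted:
  fixes w :: "'i \<Rightarrow> real"
  assumes rq: "0 < r" "r < q" and w: "\<And>i. w i > 0"
    and K: "(\<Sum>\<^sub>\<infinity>i\<in>I. ennreal (w i powr (- (1 / (1 / enn2real r - 1 / enn2real q))))) < \<infinity>"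
  obtains C :: real where "C > 0"
    "\<And>b. lq_norm r I b \<le> ennreal C * lq_norm q I (\<lambda>i. ennreal (w i) * b i)"
proof -
  define M where "M = ennpowr (1 + (\<Sum>\<^sub>\<infinity>i\<in>I.
    ennreal (w i powr (- (1 / (1 / enn2real r - 1 / enn2real q)))))) (1 / enn2real r)"
  have q0: "q > 0"
    using rq by simp
  have r: "r \<noteq> \<infinity>" "enn2real r > 0"
    using rq by (auto intro: enn2real_exponent_pos)
  have "ennpowr 1 (1 / enn2real r) \<le> M"
    unfolding M_def using r by (intro ennpowr_mono) auto
  then have "1 \<le> M"
    by simp
  moreover have "M < \<infinity>"
    using K by (auto simp: M_def ennpowr_def)
  ultimately obtain C where C: "C > 0" "M = ennreal C"
    by (cases M) (auto simp: order_less_le_trans)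
  have "lq_norm r I b \<le> ennreal C * lq_norm q I (\<lambda>i. ennreal (w i) * b i)" for b
  proof -
    define B where "B = lq_norm q I (\<lambda>i. ennreal (w i) * b i)"
    have scaled: "ennreal c * lq_norm r I b \<le> M" if "ennreal c * B \<le> 1" for c
    proof -
      have "lq_norm q I (\<lambda>i. ennreal (w i) * (ennreal c * b i)) = ennreal c * B"
        unfolding B_def by (subst lq_norm_cmult[OF q0, symmetric]) (simp add: mult_ac)
      with that have "lq_norm r I (\<lambda>i. ennreal c * b i) \<le> M"
        unfolding M_def by (intro lq_norm_weighted_normalised rq w) simp
      then show ?thesis
        using rq by (simp add: lq_norm_cmult)
    qed
    consider "B = top" | "B = 0" | \<beta> where "\<beta> > 0" "B = ennreal \<beta>"
      by (cases B) (auto simp: less_le)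
    then show ?thesis
    proof cases
      case 1
      with C show ?thesis
        by (simp add: B_def ennreal_mult_top)
    next
      case 2
      have "b i = 0" if "i \<in> I" for i
        using le_lq_norm[OF q0 that, of "\<lambda>i. ennreal (w i) * b i"] 2 w[of i]
        by (simp add: B_def)
      then have "lq_norm r I b \<le> lq_norm r I (\<lambda>i. 0 * b i)"
        using rq by (intro lq_norm_mono) auto
      then show ?thesis
        using rq by (simp only: lq_norm_cmult) simp
    next
      case 3
      have "ennreal (1 / \<beta>) * B = 1"
        using 3 by (simp flip: ennreal_mult)
      then have "ennreal (1 / \<beta>) * lq_norm r I b \<le> M"
        using scaled[of "1 / \<beta>"] by simp
      then have "ennreal \<beta> * (ennreal (1 / \<beta>) * lq_norm r I b) \<le> ennreal \<beta> * M"
        by (rule mult_left_mono) simp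
      moreover have "ennreal \<beta> * (ennreal (1 / \<beta>) * lq_norm r I b) = lq_norm r I b"
        using 3 by (simp flip: mult.assoc ennreal_mult)
      ultimately show ?thesis
        using 3 C by (simp add: B_def mult.commute)
    qed
  qed
  with C that show thesis
    by blast
qed


section \<open>Weights on the integer lattice\<close>

lemma summable_on_nat_bracket:
  fixes \<tau> :: real
  assumes "\<tau> > 1"
  shows "(\<lambda>n::nat. sqrt (1 + (real n)\<^sup>2) powr (- \<tau>)) summable_on UNIV"
proof -
  have "summable (\<lambda>n::nat. norm (sqrt (1 + (real n)\<^sup>2) powr (- \<tau>)))"
  proof (rule summable_comparison_test_ev)
    show "summable (\<lambda>n. real n powr (- \<tau>))"
      using assms by (subst summable_real_powr_iff) simp
    show "\<forall>\<^sub>F n in sequentially. norm (norm (sqrt (1 + (real n)\<^sup>2) powr (- \<tau>))) \<le> real n powr (- \<tau>)"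
      \<comment> \<open>The comparison fails at \<open>n = 0\<close>, because \<open>0 powr - \<tau> = 0\<close>.\<close>
      using eventually_gt_at_top[of 0]
    proof eventually_elim
      case (elim n)
      have "real n \<le> sqrt (1 + (real n)\<^sup>2)"
        by (rule real_le_rsqrt) simp
      then have "sqrt (1 + (real n)\<^sup>2) powr (- \<tau>) \<le> real n powr (- \<tau>)"
        using elim assms by (intro powr_mono2') auto
      then show ?case
        by (simp only: real_norm_def abs_of_nonneg powr_ge_zero)
    qed
  qed
  then show ?thesis
    by (rule norm_summable_imp_summable_on)
qed

lemma summable_on_int_bracket:
  fixes \<tau> :: real
  assumes "\<tau> > 1"
  shows "(\<lambda>j::int. sqrt (1 + (of_int j)\<^sup>2) powr (- \<tau>)) summable_on UNIV"
proof -
  let ?f = "\<lambda>j::int. sqrt (1 + (of_int j)\<^sup>2) powr (- \<tau>)"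
  have "?f summable_on range int"
    using summable_on_nat_bracket[OF assms]
    by (subst summable_on_reindex) (auto simp: o_def)
  moreover have "?f summable_on range (\<lambda>n. - int n)"
    using summable_on_nat_bracket[OF assms]
    by (subst summable_on_reindex) (auto simp: o_def inj_on_def)
  ultimately have "?f summable_on (range int \<union> range (\<lambda>n. - int n))"
    by (rule summable_on_union)
  moreover have "range int \<union> range (\<lambda>n. - int n) = UNIV"
  proof -
    have "j \<in> range int \<union> range (\<lambda>n. - int n)" for j
      by (cases j rule: int_cases2) auto
    then show ?thesis
      by auto
  qed
  ultimately show ?thesis
    by simp
qed

lemma bracket_square:
  fixes k :: "int ^ 'n::{finite,linorder}"
  shows "(bracket k)\<^sup>2 = (bracket_bar k)\<^sup>2 + (of_int (k $ last_index))\<^sup>2"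
proof -
  have "(\<Sum>i\<in>UNIV. (real_of_int (k $ i))\<^sup>2)
      = (of_int (k $ last_index))\<^sup>2 + (\<Sum>i\<in>UNIV - {last_index}. (of_int (k $ i))\<^sup>2)"
    by (rule sum.remove) auto
  then show ?thesis
    by (simp add: bracket_def bracket_bar_def sum_nonneg add_nonneg_nonneg)
qed

lemma one_le_bracket_bar: "1 \<le> bracket_bar k"
  by (simp add: bracket_bar_def sum_nonneg)

lemma bracket_bar_le_bracket: "bracket_bar k \<le> bracket k"
proof (rule power2_le_imp_le)
  show "(bracket_bar k)\<^sup>2 \<le> (bracket k)\<^sup>2"
    by (simp add: bracket_square)
  show "0 \<le> bracket k"
    by (simp add: bracket_def sum_nonneg add_nonneg_nonneg)
qed

lemma bracket_last_le_bracket: "sqrt (1 + (of_int (k $ last_index))\<^sup>2) \<le> bracket k"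
proof (rule real_le_lsqrt)
  show "0 \<le> bracket k"
    using one_le_bracket_bar[of k] bracket_bar_le_bracket[of k] by linarith
  show "1 + (of_int (k $ last_index))\<^sup>2 \<le> (bracket k)\<^sup>2"
    using one_le_bracket_bar[of k] by (simp add: bracket_square)
qed

text \<open>
  Both \<open>\<langle>k\<^sub>n\<rangle>\<close> and \<open>\<langle>k\<^bsub>bar\<^esub>\<rangle>\<close> lie between \<open>1\<close> and \<open>\<langle>k\<rangle>\<close>, so the weight \<open>\<langle>k\<rangle>\<^sup>s\<close> can be shared between
  them. Negative \<open>s'\<close> may not be used to enlarge \<open>t\<close>, since \<open>\<langle>k\<^bsub>bar\<^esub>\<rangle>\<^bsup>s'\<^esup> \<le> 1\<close> becomes an equality at
  \<open>k\<^bsub>bar\<^esub> = 0\<close>.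
\<close>

lemma bracket_weight_split:
  fixes s s' t :: real
  assumes "0 \<le> t" "t + max s' 0 \<le> s"
  shows "sqrt (1 + (of_int (k $ last_index))\<^sup>2) powr t * bracket_bar k powr s' \<le> bracket k powr s"
proof -
  have 1: "1 \<le> bracket_bar k" "1 \<le> bracket k"
    using one_le_bracket_bar[of k] bracket_bar_le_bracket[of k] by linarith+
  have "bracket_bar k powr s' \<le> bracket_bar k powr max s' 0"
    using 1 by (intro powr_mono) auto
  also have "\<dots> \<le> bracket k powr max s' 0"
    using 1 bracket_bar_le_bracket[of k] by (intro powr_mono2) auto
  finally have "sqrt (1 + (of_int (k $ last_index))\<^sup>2) powr t * bracket_bar k powr s'
      \<le> bracket k powr t * bracket k powr max s' 0"
    using assms bracket_last_le_bracket[of k] by (intro mult_mono powr_mono2) auto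
  also have "\<dots> \<le> bracket k powr s"
    using 1 assms by (auto simp flip: powr_add intro!: powr_mono)
  finally show ?thesis .
qed


section \<open>Comparison of the sequence quasi-norms\<close>

lemma aniso_lq_norm_le:
  fixes c :: "int ^ 'n::{finite,linorder} \<Rightarrow> real"
  assumes "0 < q" "q \<le> r" "s \<ge> 0" "\<And>k. c k \<ge> 0"
  shows "lq_norm r (UNIV :: int set) (\<lambda>j. lq_norm q {k. k $ last_index = j}
      (\<lambda>k. ennreal (bracket_bar k powr s * c k)))
    \<le> lq_norm q UNIV (\<lambda>k. ennreal (bracket k powr s * c k))"
proof -
  have "lq_norm r (UNIV :: int set) (\<lambda>j. lq_norm q {k. k $ last_index = j}
      (\<lambda>k. ennreal (bracket_bar k powr s * c k)))
    \<le> lq_norm q UNIV (\<lambda>j. lq_norm q {k. k $ last_index = j}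
      (\<lambda>k. ennreal (bracket_bar k powr s * c k)))"
    using assms by (intro lq_norm_antimono_exponent)
  also have "\<dots> \<le> lq_norm q UNIV (\<lambda>k. ennreal (bracket_bar k powr s * c k))"
    using assms by (intro lq_norm_slices_le)
  also have "\<dots> \<le> lq_norm q UNIV (\<lambda>k. ennreal (bracket k powr s * c k))"
    using assms one_le_bracket_bar bracket_bar_le_bracket
    by (intro lq_norm_mono ennreal_leI mult_right_mono powr_mono2)
      (auto intro: order_trans[OF zero_le_one])
  finally show ?thesis .
qed

text \<open>
  The weight \<open>\<langle>j\<rangle>\<^sup>t\<close> demanded by Hoelder's inequality in \<open>j = k\<^sub>n\<close> is constant on the slice \<open>k\<^sub>n = j\<close>,
  so it can be moved inside the inner norm and absorbed there into \<open>\<langle>k\<rangle>\<^sup>s\<close>. Both hypotheses on \<open>s\<close> and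
  \<open>s'\<close> together say that \<open>t = s - max s' 0\<close> exceeds \<open>1/r - 1/q\<close>.
\<close>

lemma aniso_lq_norm_le_weighted:
  fixes s s' :: real and q r :: ennreal
  assumes rq: "0 < r" "r < q"
    and s: "s > 1 / enn2real r - 1 / enn2real q"
    and s': "s' < s - (1 / enn2real r - 1 / enn2real q)"
  obtains C :: real where "C > 0"
    "\<And>c :: int ^ 'n::{finite,linorder} \<Rightarrow> real. (\<And>k. c k \<ge> 0) \<Longrightarrow>
      lq_norm r (UNIV :: int set) (\<lambda>j. lq_norm q {k. k $ last_index = j}
        (\<lambda>k. ennreal (bracket_bar k powr s' * c k)))
      \<le> ennreal C * lq_norm q UNIV (\<lambda>k. ennreal (bracket k powr s * c k))"
proof -
  define \<delta> where "\<delta> = 1 / enn2real r - 1 / enn2real q"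
  define t where "t = s - max s' 0"
  define w where "w = (\<lambda>j::int. sqrt (1 + (of_int j)\<^sup>2) powr t)"
  have q0: "q > 0"
    using rq by simp
  have \<delta>: "\<delta> > 0"
    using exponent_gap_pos[OF rq] by (simp add: \<delta>_def)
  have t: "t > \<delta>"
    using s s' by (auto simp: t_def \<delta>_def max_def)
  have w: "w j > 0" for j
    by (simp add: w_def add_pos_nonneg less_imp_neq[THEN not_sym])
  have "(\<Sum>\<^sub>\<infinity>j\<in>UNIV. ennreal (w j powr (- (1 / \<delta>)))) < \<infinity>"
  proof -
    have "t / \<delta> > 1"
      using t \<delta> by simp
    then have "(\<lambda>j. w j powr (- (1 / \<delta>))) summable_on UNIV"
      using summable_on_int_bracket[of "t / \<delta>"] by (simp add: w_def powr_powr)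
    then show ?thesis
      by (rule infsum_ennreal_finite) simp
  qed
  then obtain C where C: "C > 0"
    "\<And>b. lq_norm r UNIV b \<le> ennreal C * lq_norm q UNIV (\<lambda>j. ennreal (w j) * b j)"
    using lq_norm_le_weighted[OF rq, where w = w and I = UNIV] w unfolding \<delta>_def by blast
  show thesis
  proof (rule that[OF C(1)])
    fix c :: "(int, 'n) vec \<Rightarrow> real"
    assume c: "\<And>k. c k \<ge> 0"
    let ?a = "\<lambda>k. ennreal (bracket_bar k powr s' * c k)"
    have "lq_norm r UNIV (\<lambda>j. lq_norm q {k. k $ last_index = j} ?a)
      \<le> ennreal C * lq_norm q UNIV (\<lambda>j. ennreal (w j) * lq_norm q {k. k $ last_index = j} ?a)"
      by (rule C)
    also have "(\<lambda>j. ennreal (w j) * lq_norm q {k. k $ last_index = j} ?a)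
      = (\<lambda>j. lq_norm q {k. k $ last_index = j} (\<lambda>k. ennreal (w j) * ?a k))"
      using q0 by (simp add: lq_norm_cmult)
    also have "lq_norm q UNIV \<dots>
      \<le> lq_norm q UNIV (\<lambda>j. lq_norm q {k. k $ last_index = j}
          (\<lambda>k. ennreal (bracket k powr s * c k)))"
    proof (intro lq_norm_mono q0)
      fix j and k :: "(int, 'n) vec"
      assume "k \<in> {k. k $ last_index = j}"
      moreover have "w (k $ last_index) * bracket_bar k powr s' \<le> bracket k powr s"
        unfolding w_def using t \<delta> by (intro bracket_weight_split) (auto simp: t_def)
      ultimately have "w j * bracket_bar k powr s' * c k \<le> bracket k powr s * c k"
        using c by (intro mult_right_mono) auto
      then show "ennreal (w j) * ?a k \<le> ennreal (bracket k powr s * c k)"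
        using w[of j] c[of k] by (simp add: ennreal_leI mult.assoc flip: ennreal_mult)
    qed
    also have "\<dots> \<le> lq_norm q UNIV (\<lambda>k. ennreal (bracket k powr s * c k))"
      using q0 by (rule lq_norm_slices_le)
    finally show "lq_norm r UNIV (\<lambda>j. lq_norm q {k. k $ last_index = j} ?a)
      \<le> ennreal C * lq_norm q UNIV (\<lambda>k. ennreal (bracket k powr s * c k))"
      by (simp add: mult_left_mono)
  qed
qed


section \<open>From pointwise estimates to embeddings\<close>

text \<open>
  Scaling by a positive finite constant maps the simple functions below \<open>f\<close> onto those below the
  scaled function, whether or not \<open>f\<close> is measurable.
\<close>

lemma nn_integral_cmult_le:
  assumes "C > 0"
  shows "(\<integral>\<^sup>+x. ennreal C * f x \<partial>M) \<le> ennreal C * (\<integral>\<^sup>+x. f x \<partial>M)"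
  unfolding nn_integral_def[of M "\<lambda>x. ennreal C * f x"]
proof (rule SUP_least)
  fix g
  assume "g \<in> {g. simple_function M g \<and> g \<le> (\<lambda>x. ennreal C * f x)}"
  then have g: "simple_function M g" "\<And>x. g x \<le> ennreal C * f x"
    by (auto simp: le_fun_def)
  define h where "h = (\<lambda>x. ennreal (1 / C) * g x)"
  have h: "simple_function M h"
    unfolding h_def using g by auto
  have inv: "ennreal C * (ennreal (1 / C) * y) = y" "ennreal (1 / C) * (ennreal C * y) = y" for y
    using assms by (simp_all flip: mult.assoc ennreal_mult)
  have "h x \<le> f x" for x
    using mult_left_mono[OF g(2)[of x], of "ennreal (1 / C)"] by (simp add: h_def inv)
  then have "integral\<^sup>S M h \<le> integral\<^sup>N M f"
    unfolding nn_integral_def using h by (intro SUP_upper) (auto simp: le_fun_def)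
  moreover have "integral\<^sup>S M g = ennreal C * integral\<^sup>S M h"
    using h by (simp flip: simple_integral_mult) (simp add: h_def inv)
  ultimately show "integral\<^sup>S M g \<le> ennreal C * integral\<^sup>N M f"
    by (simp add: mult_left_mono)
qed

lemma Lp_norm_le_cmult:
  assumes "p > 0" "C > 0" and le: "\<And>x. G x \<le> ennreal C * F x"
  shows "Lp_norm p G \<le> ennreal C * Lp_norm p F"
proof (cases "p = \<infinity>")
  case True
  have inv: "ennreal C * (ennreal (1 / C) * y) = y" "ennreal (1 / C) * (ennreal C * y) = y" for y
    using assms by (simp_all flip: mult.assoc ennreal_mult)
  have "ennreal (1 / C) * Lp_norm p G \<le> d" if d: "AE x in lborel. F x \<le> d" for d
  proof -
    have "AE x in lborel. G x \<le> ennreal C * d"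
      using d by eventually_elim (rule order_trans[OF le mult_left_mono], auto)
    then have "Lp_norm p G \<le> ennreal C * d"
      using True by (auto simp: Lp_norm_def intro: Inf_lower)
    from mult_left_mono[OF this, of "ennreal (1 / C)"] show ?thesis
      by (simp add: inv)
  qed
  then have "ennreal (1 / C) * Lp_norm p G \<le> Lp_norm p F"
    using True by (auto simp: Lp_norm_def[of _ F] intro: Inf_greatest)
  from mult_left_mono[OF this, of "ennreal C"] show ?thesis
    by (simp add: inv)
next
  case False
  let ?p = "enn2real p"
  have p: "?p > 0"
    using assms False by (intro enn2real_exponent_pos)
  have "(\<integral>\<^sup>+x. ennpowr (G x) ?p \<partial>lborel) \<le> (\<integral>\<^sup>+x. ennreal (C powr ?p) * ennpowr (F x) ?p \<partial>lborel)"
    using ennpowr_mono[OF p le] \<open>C > 0\<close>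
    by (intro nn_integral_mono) (simp add: ennpowr_mult ennpowr_ennreal)
  also have "\<dots> \<le> ennreal (C powr ?p) * (\<integral>\<^sup>+x. ennpowr (F x) ?p \<partial>lborel)"
    using \<open>C > 0\<close> by (intro nn_integral_cmult_le) simp
  finally have "ennpowr (\<integral>\<^sup>+x. ennpowr (G x) ?p \<partial>lborel) (1 / ?p)
      \<le> ennpowr (ennreal (C powr ?p) * (\<integral>\<^sup>+x. ennpowr (F x) ?p \<partial>lborel)) (1 / ?p)"
    using p by (intro ennpowr_mono) auto
  then show ?thesis
    using p \<open>C > 0\<close> False by (simp add: Lp_norm_def ennpowr_mult ennpowr_ennreal powr_powr)
qed

lemma embedding_of_pointwise_bound:
  fixes s s' :: real and p q r :: ennreal and \<eta> :: "real \<Rightarrow> real"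
  assumes "p > 0" "C > 0"
    and le: "\<And>c :: int ^ 'n::{finite,linorder} \<Rightarrow> real. (\<And>k. c k \<ge> 0) \<Longrightarrow>
      lq_norm r (UNIV :: int set) (\<lambda>j. lq_norm q {k. k $ last_index = j}
        (\<lambda>k. ennreal (bracket_bar k powr s' * c k)))
      \<le> ennreal C * lq_norm q UNIV (\<lambda>k. ennreal (bracket k powr s * c k))"
  shows "(wiener_amalgam \<eta> p q s :: 'n distr_space) \<hookrightarrow> aniso_wiener_amalgam \<eta> p q r s'"
proof -
  have *: "aniso_wiener_norm \<eta> p q r s' f \<le> ennreal C * wiener_norm \<eta> p q s f"
    for f :: "(real, 'n) vec functional"
    unfolding aniso_wiener_norm_def wiener_norm_def
    using assms(1,2) by (rule Lp_norm_le_cmult) (rule le, simp)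
  have "aniso_wiener_norm \<eta> p q r s' f < \<infinity>" if "wiener_norm \<eta> p q s f < \<infinity>"
    for f :: "(real, 'n) vec functional"
    using *[of f] that by (auto intro: order_le_less_trans simp: ennreal_mult_less_top)
  with * \<open>C > 0\<close> show ?thesis
    unfolding cont_embedded_def wiener_amalgam_def aniso_wiener_amalgam_def by auto
qed

lemma embedding_le_exponent:
  assumes "p > 0" "0 < q" "q \<le> r" "s \<ge> 0"
  shows "(wiener_amalgam \<eta> p q s :: 'n::{finite,linorder} distr_space)
    \<hookrightarrow> aniso_wiener_amalgam \<eta> p q r s"
proof (rule embedding_of_pointwise_bound[of p 1])
  fix c :: "(int, 'n) vec \<Rightarrow> real"
  assume "\<And>k. c k \<ge> 0"
  then show "lq_norm r (UNIV :: int set) (\<lambda>j. lq_norm q {k. k $ last_index = j}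
      (\<lambda>k. ennreal (bracket_bar k powr s * c k)))
    \<le> ennreal 1 * lq_norm q UNIV (\<lambda>k. ennreal (bracket k powr s * c k))"
    using aniso_lq_norm_le[OF assms(2-4), of c] by simp
qed (use assms in auto)

lemma embedding_less_exponent:
  assumes "p > 0" "0 < r" "r < q" "s > 1 / enn2real r - 1 / enn2real q"
    "s' < s - (1 / enn2real r - 1 / enn2real q)"
  shows "(wiener_amalgam \<eta> p q s :: 'n::{finite,linorder} distr_space)
    \<hookrightarrow> aniso_wiener_amalgam \<eta> p q r s'"
proof (rule aniso_lq_norm_le_weighted[OF assms(2-), where ?'n = 'n])
  fix C :: real
  assume "C > 0" and le: "\<And>c :: (int, 'n) vec \<Rightarrow> real. (\<And>k. c k \<ge> 0) \<Longrightarrow>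
      lq_norm r (UNIV :: int set) (\<lambda>j. lq_norm q {k. k $ last_index = j}
        (\<lambda>k. ennreal (bracket_bar k powr s' * c k)))
      \<le> ennreal C * lq_norm q UNIV (\<lambda>k. ennreal (bracket k powr s * c k))"
  show ?thesis
    using assms(1) \<open>C > 0\<close> by (rule embedding_of_pointwise_bound) (rule le)
qed

theorem theorem2p1:
  fixes \<eta> :: "real \<Rightarrow> real" and p q r :: ennreal and s :: real
  assumes "CARD('n::{finite,linorder}) \<ge> 2"
    and "cutoff \<eta>"
    and "p > 0" and "q > 0" and "r > 0" and "s \<ge> 0"
  shows
    "(r = q \<and> q = \<infinity> \<longrightarrow>
        (wiener_amalgam \<eta> p \<infinity> s :: 'n distr_space) \<hookrightarrow> aniso_wiener_amalgam \<eta> p \<infinity> \<infinity> s) \<and>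
     (r = q \<and> q < \<infinity> \<longrightarrow>
        (wiener_amalgam \<eta> p q s :: 'n distr_space) \<hookrightarrow> aniso_wiener_amalgam \<eta> p q q s) \<and>
     (r < q \<and> q = \<infinity> \<and> s > 1 / enn2real r \<longrightarrow>
        (\<forall>s'. s' < s - 1 / enn2real r \<longrightarrow>
          (wiener_amalgam \<eta> p \<infinity> s :: 'n distr_space) \<hookrightarrow> aniso_wiener_amalgam \<eta> p \<infinity> r s')) \<and>
     (r < q \<and> q < \<infinity> \<and> s > 1 / enn2real r - 1 / enn2real q \<longrightarrow>
        (\<forall>s'. s' < s - (1 / enn2real r - 1 / enn2real q) \<longrightarrow>
          (wiener_amalgam \<eta> p q s :: 'n distr_space) \<hookrightarrow> aniso_wiener_amalgam \<eta> p q r s')) \<and>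
     (q < r \<and> r = \<infinity> \<longrightarrow>
        (wiener_amalgam \<eta> p q s :: 'n distr_space) \<hookrightarrow> aniso_wiener_amalgam \<eta> p q \<infinity> s) \<and>
     (q < r \<and> r < \<infinity> \<longrightarrow>
        (wiener_amalgam \<eta> p q s :: 'n distr_space) \<hookrightarrow> aniso_wiener_amalgam \<eta> p q r s)"
proof (intro conjI impI allI; (elim conjE)?)
  fix s' assume "r < q" "q = \<infinity>" "s > 1 / enn2real r" "s' < s - 1 / enn2real r"
  \<comment> \<open>For \<open>q = \<infinity>\<close> the term \<open>1 / enn2real q\<close> vanishes, because \<open>enn2real \<infinity> = 0\<close>.\<close>
  with assms show "(wiener_amalgam \<eta> p \<infinity> s :: 'n distr_space) \<hookrightarrow> aniso_wiener_amalgam \<eta> p \<infinity> r s'"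
    using embedding_less_exponent[of p r \<infinity> s s' \<eta>] by simp
qed (use assms in \<open>auto intro!: embedding_le_exponent embedding_less_exponent\<close>)

end
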